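(* Let $(K,\mathrm{dist})$ be a compact metric space, let $f$ be a homeomorphism of $K$, and let $\mu$ be a nonatomic Borel probability measure on $K$ that is compatible with inverse shadowing for $f$ and satisfies $\mathrm{supp}(\mu)=K$. Then $f$ has the inverse shadowing property.
   Context: A method is a sequence $g=\{g_k\}_{k\in\mathbb{Z}}$ of continuous mappings $g_k:K\to K$; a trajectory of $g$ is a sequence $\{y_k\}_{k\in\mathbb{Z}}$ in $K$ with $y_{k+1}=g_k(y_k)$ for all $k\in\mathbb{Z}$. For $d>0$, $g$ is a $d$-method for $f$ if $\max_{x\in K}\mathrm{dist}(g_k(x),f(x))\le d$ for all $k\in\mathbb{Z}$. A homeomorphism $f$ has the inverse shadowing property ($f\in\mathrm{IS}$) if for any $\varepsilon>0$ there exists a $d>0$ such that for any $x\in K$ and any $d$-method $g$ for $f$ there exists a trajectory $\{y_k\}_{k\in\mathbb{Z}}$ of $g$ such that $\mathrm{dist}(f^k(x),y_k)\le\varepsilon$ for all $k\in\mathbb{Z}$. For $\varepsilon,d>0$, $\Phi(\varepsilon,d,f)$ is the set of all points $x\in K$ such that for any $d$-method $g$ for $f$ there exists a trajectory $\{y_k\}$ of $g$ with $\mathrm{dist}(f^k(x),y_k)\le\varepsilon$ for all $k\in\mathbb{Z}$. A nonatomic Borel probability measure $\mu$ on $K$ is compatible with inverse shadowing for $f$ if for any $\varepsilon>0$ there exists a $d>0$ such that $A\cap\Phi(\varepsilon,d,f)\neq\emptyset$ for every (measurable) set $A$ with $\mu(A)>0$. *)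

theory Defs
  imports "HOL-Analysis.Analysis" "HOL-Probability.Probability"
begin

text \<open>
  The compact metric space is a compact subset \<open>K\<close> of a type of class \<open>metric_space\<close>, with the
  induced metric. Maps of \<open>K\<close> are total functions on the type; only their values on \<open>K\<close> matter.
\<close>

definition is_method :: "'a::metric_space set \<Rightarrow> (int \<Rightarrow> 'a \<Rightarrow> 'a) \<Rightarrow> bool" where
  "is_method K g \<longleftrightarrow> (\<forall>k. continuous_on K (g k) \<and> g k ` K \<subseteq> K)"

definition trajectory :: "'a::metric_space set \<Rightarrow> (int \<Rightarrow> 'a \<Rightarrow> 'a) \<Rightarrow> (int \<Rightarrow> 'a) \<Rightarrow> bool" where
  "trajectory K g y \<longleftrightarrow> (\<forall>k. y k \<in> K \<and> y (k + 1) = g k (y k))"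

definition d_method ::
  "'a::metric_space set \<Rightarrow> ('a \<Rightarrow> 'a) \<Rightarrow> real \<Rightarrow> (int \<Rightarrow> 'a \<Rightarrow> 'a) \<Rightarrow> bool" where
  "d_method K f d g \<longleftrightarrow> is_method K g \<and> (\<forall>k. \<forall>x\<in>K. dist (g k x) (f x) \<le> d)"

text \<open>Integer powers of a bijection \<open>f\<close> of \<open>K\<close>, meaningful on points of \<open>K\<close>.\<close>

definition int_iterate :: "'a set \<Rightarrow> ('a \<Rightarrow> 'a) \<Rightarrow> int \<Rightarrow> 'a \<Rightarrow> 'a" where
  "int_iterate K f k = (if k \<ge> 0 then f ^^ nat k else inv_into K f ^^ nat (- k))"

definition inverse_shadowing :: "'a::metric_space set \<Rightarrow> ('a \<Rightarrow> 'a) \<Rightarrow> bool" where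
  "inverse_shadowing K f \<longleftrightarrow>
    (\<forall>\<epsilon>>0. \<exists>d>0. \<forall>x\<in>K. \<forall>g. d_method K f d g \<longrightarrow>
      (\<exists>y. trajectory K g y \<and> (\<forall>k. dist (int_iterate K f k x) (y k) \<le> \<epsilon>)))"

definition shadowable_points ::
  "'a::metric_space set \<Rightarrow> real \<Rightarrow> real \<Rightarrow> ('a \<Rightarrow> 'a) \<Rightarrow> 'a set" where
  "shadowable_points K \<epsilon> d f =
    {x \<in> K. \<forall>g. d_method K f d g \<longrightarrow>
      (\<exists>y. trajectory K g y \<and> (\<forall>k. dist (int_iterate K f k x) (y k) \<le> \<epsilon>))}"

definition compatible_inverse_shadowing ::
  "'a::metric_space set \<Rightarrow> ('a \<Rightarrow> 'a) \<Rightarrow> 'a measure \<Rightarrow> bool" where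
  "compatible_inverse_shadowing K f \<mu> \<longleftrightarrow>
    (\<forall>\<epsilon>>0. \<exists>d>0. \<forall>A\<in>sets \<mu>. emeasure \<mu> A > 0 \<longrightarrow> A \<inter> shadowable_points K \<epsilon> d f \<noteq> {})"

text \<open>The relation \<open>sets \<mu> = sets (restrict_space borel K)\<close> also forces \<open>space \<mu> = K\<close>.\<close>

definition borel_probability_on :: "'a::topological_space set \<Rightarrow> 'a measure \<Rightarrow> bool" where
  "borel_probability_on K \<mu> \<longleftrightarrow> prob_space \<mu> \<and> sets \<mu> = sets (restrict_space borel K)"

definition measure_atom :: "'a measure \<Rightarrow> 'a set \<Rightarrow> bool" where
  "measure_atom \<mu> A \<longleftrightarrow> A \<in> sets \<mu> \<and> emeasure \<mu> A > 0 \<and>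
    (\<forall>B\<in>sets \<mu>. B \<subseteq> A \<longrightarrow> emeasure \<mu> B = 0 \<or> emeasure \<mu> (A - B) = 0)"

definition nonatomic :: "'a measure \<Rightarrow> bool" where
  "nonatomic \<mu> \<longleftrightarrow> \<not> (\<exists>A. measure_atom \<mu> A)"

text \<open>The sets \<open>U \<inter> space \<mu>\<close> with \<open>U\<close> open are the relatively open subsets of the space.\<close>

definition measure_supp :: "'a::topological_space measure \<Rightarrow> 'a set" where
  "measure_supp \<mu> = {x \<in> space \<mu>. \<forall>U. open U \<and> x \<in> U \<longrightarrow> emeasure \<mu> (U \<inter> space \<mu>) > 0}"

end

theory Submission
  imports Defs
begin

text \<open>
  For fixed \<open>\<epsilon>\<close> and \<open>d\<close>, \<open>\<Phi>(\<epsilon>, d, f)\<close> is closed: by sequential compactness of the product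
  \<open>K\<close> to the power \<open>\<int>\<close>, the trajectories of a \<open>d\<close>-method that shadow the orbits of points
  converging to \<open>x\<close> subconverge coordinatewise to a trajectory that shadows the orbit of \<open>x\<close>.
  Full support makes every nonempty relatively open set a set of positive measure, so compatibility
  makes \<open>\<Phi>(\<epsilon>, d, f)\<close> dense in \<open>K\<close>, hence equal to \<open>K\<close>.
\<close>

text \<open>Tychonoff's theorem, carried over to the topology of the function type, which is the
  product topology. It is applied to the space of bi-infinite sequences in \<open>K\<close>.\<close>

lemma compact_Pi_UNIV:
  fixes K :: "'b::topological_space set"
  assumes "compact K"
  shows "compact {y :: 'i \<Rightarrow> 'b. \<forall>i. y i \<in> K}"
proof -
  have "compactin (product_topology (\<lambda>_::'i. euclidean :: 'b topology) UNIV) (PiE UNIV (\<lambda>_. K))"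
    using assms by (subst compactin_PiE) simp
  moreover have "PiE UNIV (\<lambda>_::'i. K) = {y. \<forall>i. y i \<in> K}"
    by (auto simp: PiE_def Pi_def)
  ultimately show ?thesis
    by (simp add: euclidean_product_topology)
qed

lemma int_iterate_continuous_on:
  assumes "homeomorphism K K f f'"
  shows "continuous_on K (int_iterate K f k)"
proof -
  have pow: "continuous_on K (h ^^ n)" if "continuous_on K h" "h ` K \<subseteq> K" for h :: "'a \<Rightarrow> 'a" and n
  proof (induction n)
    case (Suc n)
    then have "continuous_on K ((h ^^ n) \<circ> h)"
      using that by (blast intro: continuous_on_compose continuous_on_subset)
    then show ?case
      by (simp add: funpow_Suc_right del: funpow.simps)
  qed simp
  \<comment> \<open>Negative powers inherit continuity from \<open>f'\<close>, since the two
    inverses agree on \<open>K\<close>.\<close>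
  have inv: "inv_into K f x = f' x" if "x \<in> K" for x
    using assms that
    by (metis homeomorphism_apply2 homeomorphism_apply1 homeomorphism_image2 imageI inj_onI inv_into_f_f)
  have "continuous_on K f" "f ` K \<subseteq> K" "continuous_on K (inv_into K f)" "inv_into K f ` K \<subseteq> K"
    using assms by (auto simp: homeomorphism_def inv cong: continuous_on_cong_simp)
  then show ?thesis
    by (simp add: int_iterate_def pow)
qed

lemma limit_in_shadowable_points:
  fixes K :: "'a::metric_space set"
  assumes "compact K" and cont: "\<And>k. continuous_on K (int_iterate K f k)"
    and x: "x \<in> K" and X: "\<And>n. X n \<in> shadowable_points K \<epsilon> d f" and lim: "X \<longlonglongrightarrow> x"
  shows "x \<in> shadowable_points K \<epsilon> d f"
  unfolding shadowable_points_def
proof (intro CollectI conjI allI impI x)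
  fix g assume g: "d_method K f d g"
  have "\<forall>n. \<exists>y. trajectory K g y \<and> (\<forall>k. dist (int_iterate K f k (X n)) (y k) \<le> \<epsilon>)"
    using X g by (auto simp: shadowable_points_def)
  then obtain Y where traj: "\<And>n. trajectory K g (Y n)"
    and close: "\<And>n k. dist (int_iterate K f k (X n)) (Y n k) \<le> \<epsilon>"
    by metis
  have YK: "Y n k \<in> K" for n k
    using traj by (auto simp: trajectory_def)
  \<comment> \<open>As \<open>int\<close> is countable, the product is first countable, so
    compactness gives sequential compactness: a single subsequence \<open>r\<close> works for all
    times \<open>k\<close> at once.\<close>
  have "seq_compact {y :: int \<Rightarrow> 'a. \<forall>i. y i \<in> K}"
    by (intro compact_imp_seq_compact compact_Pi_UNIV assms)
  then obtain y r where y: "\<forall>k. y k \<in> K" and r: "strict_mono r" and "(Y \<circ> r) \<longlonglongrightarrow> y"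
    using YK by (auto elim: seq_compactE[where f = Y])
  have Ylim: "(\<lambda>n. Y (r n) k) \<longlonglongrightarrow> y k" for k
  proof -
    have "continuous_on UNIV (\<lambda>z :: int \<Rightarrow> 'a. z k)"
      by simp
    from continuous_on_tendsto_compose[OF this \<open>(Y \<circ> r) \<longlonglongrightarrow> y\<close>] show ?thesis
      by (simp add: o_def)
  qed
  have "y (k + 1) = g k (y k)" for k
  proof -
    have "continuous_on K (g k)"
      using g by (simp add: d_method_def is_method_def)
    \<comment> \<open>Continuity of \<open>g k\<close> is known only on \<open>K\<close>, so the
      limit \<open>y k\<close> and the approximating points must all lie there.\<close>
    then have "(\<lambda>n. g k (Y (r n) k)) \<longlonglongrightarrow> g k (y k)"
      using Ylim y YK by (auto intro: continuous_on_tendsto_compose)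
    moreover have "g k (Y (r n) k) = Y (r n) (k + 1)" for n
      using traj by (simp add: trajectory_def)
    ultimately have "(\<lambda>n. Y (r n) (k + 1)) \<longlonglongrightarrow> g k (y k)"
      by simp
    then show ?thesis
      by (rule LIMSEQ_unique[OF Ylim])
  qed
  moreover have "dist (int_iterate K f k x) (y k) \<le> \<epsilon>" for k
  \<comment> \<open>The bound is not strict, so it passes to the limit with the same
    \<epsilon>.\<close>
  proof (rule LIMSEQ_le_const2)
    have "X n \<in> K" for n
      using X by (auto simp: shadowable_points_def)
    then have "(\<lambda>n. int_iterate K f k (X (r n))) \<longlonglongrightarrow> int_iterate K f k x"
      using LIMSEQ_subseq_LIMSEQ[OF lim r] x
      by (auto simp: o_def intro: continuous_on_tendsto_compose[OF cont])
    then show "(\<lambda>n. dist (int_iterate K f k (X (r n))) (Y (r n) k)) \<longlonglongrightarrow> dist (int_iterate K f k x) (y k)"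
      by (intro tendsto_dist Ylim)
  qed (use close in auto)
  ultimately show "\<exists>y. trajectory K g y \<and> (\<forall>k. dist (int_iterate K f k x) (y k) \<le> \<epsilon>)"
    using y by (auto simp: trajectory_def)
qed

theorem corollary4p1:
  fixes K :: "'a::metric_space set" and f :: "'a \<Rightarrow> 'a" and \<mu> :: "'a measure"
  assumes "compact K"
    and "\<exists>f'. homeomorphism K K f f'"
    and "borel_probability_on K \<mu>"
    and "nonatomic \<mu>"
    and "compatible_inverse_shadowing K f \<mu>"
    and "measure_supp \<mu> = K"
  shows "inverse_shadowing K f"
proof -
  have sets: "sets \<mu> = sets (restrict_space borel K)"
    using assms(3) by (simp add: borel_probability_on_def)
  have space: "space \<mu> = K"
    using sets_eq_imp_space_eq[OF sets] by (simp add: space_restrict_space)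
  have cont: "continuous_on K (int_iterate K f k)" for k
    using assms(2) int_iterate_continuous_on by blast
  have "\<exists>d>0. K \<subseteq> shadowable_points K \<epsilon> d f" if "\<epsilon> > 0" for \<epsilon>
  proof -
    \<comment> \<open>This \<open>d\<close> is fixed before \<open>x\<close> and \<open>n\<close>,
      so all points approximating \<open>x\<close> below lie in one and the same set of shadowable
      points.\<close>
    obtain d where "d > 0"
      and d: "\<And>A. A \<in> sets \<mu> \<Longrightarrow> emeasure \<mu> A > 0 \<Longrightarrow> A \<inter> shadowable_points K \<epsilon> d f \<noteq> {}"
      using assms(5) \<open>\<epsilon> > 0\<close> unfolding compatible_inverse_shadowing_def by blast
    have "x \<in> shadowable_points K \<epsilon> d f" if "x \<in> K" for x
    proof -
      have "\<exists>z. z \<in> shadowable_points K \<epsilon> d f \<and> dist z x < inverse (Suc n)" for n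
      proof -
        \<comment> \<open>Shrinking relative balls around a point of the support have positive
          measure, so compatibility finds a shadowable point in each.\<close>
        define U where "U = ball x (inverse (Suc n)) \<inter> K"
        have "U \<in> sets \<mu>"
          by (auto simp: U_def sets sets_restrict_space)
        moreover have "emeasure \<mu> U > 0"
        proof -
          have "x \<in> measure_supp \<mu>"
            using that assms(6) by simp
          then have "\<forall>V. open V \<and> x \<in> V \<longrightarrow> emeasure \<mu> (V \<inter> K) > 0"
            by (simp add: measure_supp_def space)
          then show ?thesis
            by (simp add: U_def)
        qed
        ultimately show ?thesis
          using d[of U] by (auto simp: U_def dist_commute)
      qed
      then obtain X where X: "\<And>n. X n \<in> shadowable_points K \<epsilon> d f"
        and dist: "\<And>n. dist (X n) x < inverse (Suc n)"
        by metis
      have "(\<lambda>n. dist (X n) x) \<longlonglongrightarrow> 0"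
        by (rule Lim_null_comparison[OF _ LIMSEQ_inverse_real_of_nat])
          (use dist in \<open>simp add: less_imp_le del: of_nat_Suc\<close>)
      then have "X \<longlonglongrightarrow> x"
        using tendsto_dist_iff by blast
      then show ?thesis
        by (rule limit_in_shadowable_points[OF assms(1) cont that X])
    qed
    with \<open>d > 0\<close> show ?thesis by blast
  qed
  then show ?thesis
    unfolding inverse_shadowing_def shadowable_points_def subset_iff mem_Collect_eq by meson
qed

end
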